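(* For any natural number $n$, there exists a function $f$ from $D_{2n}$ to $\mathbb{Z}_{2n}$ defined as $$f(s^a r^b)=ka+2b,$$ where $a$ belongs to $\{0,1\}$, $b$ belongs to $\mathbb{Z}_n$, and $k$ is an odd integer, such that the order of $s^a r^b$ divides the order of $f(s^a r^b)$.
   Context: $D_{2n}=\langle r,s \mid r^n=1=s^2,\ rs=sr^{-1}\rangle$ is the dihedral group of order $2n$, whose elements are written as $s^a r^b$ with $a\in\{0,1\}$ and $b\in\mathbb{Z}_n$. $\mathbb{Z}_m$ denotes the additive cyclic group of integers modulo $m$, and the value $ka+2b$ is taken modulo $2n$. The order of $s^a r^b$ is taken in $D_{2n}$ and the order of $f(s^a r^b)$ in $\mathbb{Z}_{2n}$. *)

theory Defs
  imports "HOL-Algebra.Algebra"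
begin

text \<open>
  The group \<open>\<langle>X | R\<rangle>\<close> given by generators and relations. The generators are the elements of
  the type \<open>'g\<close>; the letter \<open>(x, True)\<close> stands for \<open>x\<close> and \<open>(x, False)\<close> for its formal inverse.
  A pair \<open>(l, r)\<close> in \<open>R\<close> is the relation \<open>l = r\<close>.
\<close>

type_synonym 'g gword = "('g \<times> bool) list"

inductive pres_eq :: "('g gword \<times> 'g gword) set \<Rightarrow> 'g gword \<Rightarrow> 'g gword \<Rightarrow> bool"
  for R :: "('g gword \<times> 'g gword) set" where
  refl: "pres_eq R u u"
| sym: "pres_eq R u v \<Longrightarrow> pres_eq R v u"
| trans: "pres_eq R u v \<Longrightarrow> pres_eq R v w \<Longrightarrow> pres_eq R u w"
| cancel: "pres_eq R (u @ [(x, b), (x, \<not> b)] @ v) (u @ v)"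
| rel: "(l, r) \<in> R \<Longrightarrow> pres_eq R (u @ l @ v) (u @ r @ v)"

definition pres_class :: "('g gword \<times> 'g gword) set \<Rightarrow> 'g gword \<Rightarrow> 'g gword set" where
  "pres_class R u = {v. pres_eq R u v}"

definition presented_group :: "('g gword \<times> 'g gword) set \<Rightarrow> 'g gword set monoid" where
  "presented_group R =
     \<lparr>carrier = range (pres_class R),
      monoid.mult = (\<lambda>A B. \<Union>u\<in>A. \<Union>v\<in>B. pres_class R (u @ v)),
      one = pres_class R []\<rparr>"

definition pres_gen :: "('g gword \<times> 'g gword) set \<Rightarrow> 'g \<Rightarrow> 'g gword set" where
  "pres_gen R x = pres_class R [(x, True)]"

datatype dihedral_gen = Rot | Refl

definition dihedral_rels :: "nat \<Rightarrow> (dihedral_gen gword \<times> dihedral_gen gword) set" where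
  "dihedral_rels n =
     {(replicate n (Rot, True), []),
      ([(Refl, True), (Refl, True)], []),
      ([(Rot, True), (Refl, True)], [(Refl, True), (Rot, False)])}"

text \<open>\<open>dihedral n\<close> is the dihedral group of order \<open>2n\<close>, for \<open>n \<ge> 1\<close>.\<close>

definition dihedral :: "nat \<Rightarrow> dihedral_gen gword set monoid" where
  "dihedral n = presented_group (dihedral_rels n)"

definition dih_r :: "nat \<Rightarrow> dihedral_gen gword set" where
  "dih_r n = pres_gen (dihedral_rels n) Rot"

definition dih_s :: "nat \<Rightarrow> dihedral_gen gword set" where
  "dih_s n = pres_gen (dihedral_rels n) Refl"

lemma pres_class_eq_iff: "pres_class R u = pres_class R v \<longleftrightarrow> pres_eq R u v"
proof
  assume "pres_class R u = pres_class R v"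
  moreover have "v \<in> pres_class R v" by (simp add: pres_class_def pres_eq.refl)
  ultimately have "v \<in> pres_class R u" by simp
  then show "pres_eq R u v" by (simp add: pres_class_def)
next
  assume uv: "pres_eq R u v"
  have "pres_eq R u w \<longleftrightarrow> pres_eq R v w" for w
    using pres_eq.trans[OF uv, of w] pres_eq.trans[OF pres_eq.sym[OF uv], of w] by iprover
  then show "pres_class R u = pres_class R v" by (simp add: pres_class_def)
qed

lemma pres_eq_context: "pres_eq R u v \<Longrightarrow> pres_eq R (p @ u @ q) (p @ v @ q)"
proof (induction rule: pres_eq.induct)
  case (refl u)
  show ?case by (rule pres_eq.refl)
next
  case (sym u v)
  show ?case by (rule pres_eq.sym[OF sym.IH])
next
  case (trans u v w)
  show ?case by (rule pres_eq.trans[OF trans.IH])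
next
  case (cancel u x b v)
  show ?case using pres_eq.cancel[of R "p @ u" x b "v @ q"] by simp
next
  case (rel l r u v)
  show ?case using pres_eq.rel[OF rel, of "p @ u" "v @ q"] by simp
qed

lemma pres_eq_append:
  assumes "pres_eq R u u'" "pres_eq R v v'"
  shows "pres_eq R (u @ v) (u' @ v')"
proof (rule pres_eq.trans)
  show "pres_eq R (u @ v) (u' @ v)"
    using pres_eq_context[OF assms(1), of "[]" v] by simp
  show "pres_eq R (u' @ v) (u' @ v')"
    using pres_eq_context[OF assms(2), of u' "[]"] by simp
qed

lemma presented_group_mult:
  "pres_class R u \<otimes>\<^bsub>presented_group R\<^esub> pres_class R v = pres_class R (u @ v)"
proof -
  have "pres_class R (u' @ v') = pres_class R (u @ v)"
    if "u' \<in> pres_class R u" "v' \<in> pres_class R v" for u' v'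
    unfolding pres_class_eq_iff
    by (rule pres_eq.sym, rule pres_eq_append) (use that in \<open>simp_all add: pres_class_def\<close>)
  moreover have "u \<in> pres_class R u" "v \<in> pres_class R v"
    by (simp_all add: pres_class_def pres_eq.refl)
  ultimately show ?thesis
    unfolding presented_group_def monoid.simps by blast
qed

lemma pres_eq_inverse: "pres_eq R (map (\<lambda>(x, b). (x, \<not> b)) (rev u) @ u) []"
proof (induction u)
  case Nil
  show ?case by (simp add: pres_eq.refl)
next
  case (Cons a u)
  obtain x b where a: "a = (x, b)" by (cases a)
  have "pres_eq R (map (\<lambda>(x, b). (x, \<not> b)) (rev u) @ [(x, \<not> b), (x, \<not> \<not> b)] @ u)
          (map (\<lambda>(x, b). (x, \<not> b)) (rev u) @ u)"
    by (rule pres_eq.cancel)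
  from pres_eq.trans[OF this Cons.IH] show ?case by (simp add: a)
qed

lemma group_presented_group: "group (presented_group R)"
proof (rule groupI)
  fix A assume "A \<in> carrier (presented_group R)"
  then obtain u where u: "A = pres_class R u" by (auto simp: presented_group_def)
  show "\<exists>B\<in>carrier (presented_group R). B \<otimes>\<^bsub>presented_group R\<^esub> A = \<one>\<^bsub>presented_group R\<^esub>"
  proof (rule bexI)
    let ?u' = "map (\<lambda>(x, b). (x, \<not> b)) (rev u)"
    have "pres_class R (?u' @ u) = pres_class R []"
      by (simp only: pres_class_eq_iff pres_eq_inverse)
    then show "pres_class R ?u' \<otimes>\<^bsub>presented_group R\<^esub> A = \<one>\<^bsub>presented_group R\<^esub>"
      unfolding u presented_group_mult by (simp add: presented_group_def)
    show "pres_class R ?u' \<in> carrier (presented_group R)"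
      unfolding presented_group_def monoid.simps partial_object.simps by (rule rangeI)
  qed
  show "\<one>\<^bsub>presented_group R\<^esub> \<otimes>\<^bsub>presented_group R\<^esub> A = A"
    using presented_group_mult[of R "[]" u] by (simp add: u presented_group_def)
next
  show "\<one>\<^bsub>presented_group R\<^esub> \<in> carrier (presented_group R)"
    by (simp add: presented_group_def)
next
  fix A B assume "A \<in> carrier (presented_group R)" "B \<in> carrier (presented_group R)"
  then obtain u v where uv: "A = pres_class R u" "B = pres_class R v"
    by (auto simp: presented_group_def)
  show "A \<otimes>\<^bsub>presented_group R\<^esub> B \<in> carrier (presented_group R)"
    unfolding uv presented_group_mult by (simp add: presented_group_def)
next
  fix A B C
  assume "A \<in> carrier (presented_group R)" "B \<in> carrier (presented_group R)"
    "C \<in> carrier (presented_group R)"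
  then obtain u v w where uvw: "A = pres_class R u" "B = pres_class R v" "C = pres_class R w"
    by (auto simp: presented_group_def)
  show "A \<otimes>\<^bsub>presented_group R\<^esub> B \<otimes>\<^bsub>presented_group R\<^esub> C
      = A \<otimes>\<^bsub>presented_group R\<^esub> (B \<otimes>\<^bsub>presented_group R\<^esub> C)"
    by (simp add: uvw presented_group_mult)
qed

lemma group_dihedral: "group (dihedral n)"
  unfolding dihedral_def by (rule group_presented_group)

end

theory Submission
  imports Defs
begin

text \<open>
  The difficulty is that \<open>f\<close> be well defined: the relations of the presentation bound the dihedral
  group from above, but they do not show by themselves that \<open>s\<^sup>a r\<^sup>b\<close> determines \<open>a\<close> modulo \<open>2\<close> and
  \<open>b\<close> modulo \<open>n\<close>. For this the letters act on pairs \<open>(a, b)\<close>, which stand for the formal products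
  \<open>s\<^sup>a r\<^sup>b\<close>, in the way in which left multiplication has to act. The action respects all relations
  once \<open>b\<close> is read modulo \<open>n\<close> (\<open>act_word_pres_eq\<close>), so the pair that a word makes of \<open>(0, 0)\<close>, its
  coordinates, depends only on the group element, and \<open>ka + 2b\<close> depends only on it modulo \<open>2n\<close>.

  Conversely the relations bring every word into the form \<open>s\<^sup>a r\<^sup>b\<close> given by its coordinates
  (\<open>class_eq_normal_form\<close>). The divisibility of the orders is then arithmetic. If \<open>a = 1\<close>, the
  value \<open>k + 2b\<close> is odd, so it has even order in \<open>\<int>\<^bsub>2n\<^esub>\<close>, while the reflection \<open>s r\<^sup>b\<close> squares
  to \<open>1\<close>. If \<open>a = 0\<close>, then \<open>2n\<close> divides \<open>2bd\<close> exactly if \<open>n\<close> divides \<open>bd\<close>, and in this case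
  \<open>(r\<^sup>b)\<^sup>d = 1\<close>.
\<close>

section \<open>Coordinates of words\<close>

text \<open>
  The pair \<open>(a, b)\<close> stands for \<open>s\<^sup>a r\<^sup>b\<close>, and a letter multiplies it from the left: since
  \<open>r s = s r\<inverse>\<close>, a rotation passes a reflection at the price of its sign. The letters \<open>s\<close> and
  \<open>s\<inverse>\<close> act alike. The exponent stays an integer, and is compared modulo \<open>n\<close> only afterwards.
\<close>

fun act :: "dihedral_gen \<times> bool \<Rightarrow> bool \<times> int \<Rightarrow> bool \<times> int" where
  "act (Rot, e) (a, b) = (a, if a = e then b - 1 else b + 1)"
| "act (Refl, e) (a, b) = (\<not> a, b)"

abbreviation act_word :: "dihedral_gen gword \<Rightarrow> bool \<times> int \<Rightarrow> bool \<times> int" where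
  "act_word u \<equiv> foldr act u"

definition coords :: "dihedral_gen gword \<Rightarrow> bool \<times> int" where
  "coords u = act_word u (False, 0)"

definition coords_cong :: "nat \<Rightarrow> bool \<times> int \<Rightarrow> bool \<times> int \<Rightarrow> bool" where
  "coords_cong n x y \<longleftrightarrow> fst x = fst y \<and> int n dvd snd x - snd y"

lemma coords_cong_refl: "coords_cong n x x"
  by (simp add: coords_cong_def)

lemma coords_cong_sym: "coords_cong n x y \<Longrightarrow> coords_cong n y x"
  by (auto simp: coords_cong_def dvd_diff_commute)

lemma coords_cong_trans: "coords_cong n x y \<Longrightarrow> coords_cong n y z \<Longrightarrow> coords_cong n x z"
  using dvd_add[of "int n" "snd x - snd y" "snd y - snd z"] by (simp add: coords_cong_def)

lemma act_cong: "coords_cong n x y \<Longrightarrow> coords_cong n (act l x) (act l y)"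
  by (cases l; cases "fst l"; cases x; cases y) (auto simp: coords_cong_def)

lemma act_word_cong: "coords_cong n x y \<Longrightarrow> coords_cong n (act_word u x) (act_word u y)"
  by (induction u) (auto intro: act_cong)

lemma act_cancel: "act (g, e) (act (g, \<not> e) x) = x"
  by (cases g; cases x) auto

lemma act_word_rotations:
  "act_word (replicate m (Rot, True)) (a, b) = (a, if a then b - int m else b + int m)"
  by (induction m) auto

lemma act_word_dihedral_rels:
  "(l, r) \<in> dihedral_rels n \<Longrightarrow> coords_cong n (act_word l x) (act_word r x)"
  by (cases x) (auto simp: dihedral_rels_def act_word_rotations coords_cong_def simp del: foldr_replicate)

text \<open>
  Only the relation \<open>r\<^sup>n = 1\<close> changes the exponent, by \<open>n\<close>. The statement is about all pairs \<open>x\<close>,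
  not just \<open>(0, 0)\<close>, because in a word the relation is applied in front of an arbitrary remainder.
\<close>

lemma act_word_pres_eq:
  "pres_eq (dihedral_rels n) u v \<Longrightarrow> coords_cong n (act_word u x) (act_word v x)"
proof (induction arbitrary: x rule: pres_eq.induct)
  case (refl u)
  show ?case by (rule coords_cong_refl)
next
  case (sym u v)
  show ?case by (rule coords_cong_sym[OF sym.IH])
next
  case (trans u v w)
  show ?case by (rule coords_cong_trans[OF trans.IH])
next
  case (cancel u g e v)
  show ?case by (simp add: act_cancel coords_cong_refl)
next
  case (rel l r u v)
  show ?case by (simp add: act_word_cong act_word_dihedral_rels[OF rel])
qed

section \<open>Normal forms\<close>

lemma (in group) rotation_reflection_commute:
  assumes r: "r \<in> carrier G" and s: "s \<in> carrier G" and rs: "r \<otimes> s = s \<otimes> inv r"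
  shows "r [^] (b :: int) \<otimes> s = s \<otimes> r [^] (- b)"
proof -
  \<comment> \<open>the relation for \<open>r\<inverse>\<close>, on which the induction towards negative exponents rests\<close>
  have inv_rs: "inv r \<otimes> s = s \<otimes> r"
  proof -
    have "r \<otimes> (s \<otimes> r) = s"
      using r s rs by (metis inv_closed l_inv m_assoc r_one)
    then show ?thesis
      using r s by (metis inv_solve_left m_closed)
  qed
  show ?thesis
  proof (induction b rule: int_induct[where k = 0])
    case base
    show ?case using s by simp
  next
    case (step1 i)
    have "r [^] (i + 1) \<otimes> s = r [^] i \<otimes> s \<otimes> inv r"
      using r s rs by (simp add: int_pow_mult m_assoc)
    also have "\<dots> = s \<otimes> (r [^] (- i) \<otimes> r [^] (- 1 :: int))"
      using r s step1.IH by (simp add: m_assoc int_pow_neg)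
    also have "\<dots> = s \<otimes> r [^] (- (i + 1))"
      using r by (simp flip: int_pow_mult)
    finally show ?case .
  next
    case (step2 i)
    have "r [^] (i - 1) \<otimes> s = r [^] i \<otimes> s \<otimes> r"
      using r s inv_rs by (simp add: int_pow_diff m_assoc)
    also have "\<dots> = s \<otimes> (r [^] (- i) \<otimes> r [^] (1 :: int))"
      using r s step2.IH by (simp add: m_assoc)
    also have "\<dots> = s \<otimes> r [^] (- (i - 1))"
      using r by (simp only: int_pow_mult[symmetric]) simp
    finally show ?case .
  qed
qed

lemma dihedral_mult:
  "pres_class (dihedral_rels n) u \<otimes>\<^bsub>dihedral n\<^esub> pres_class (dihedral_rels n) v
     = pres_class (dihedral_rels n) (u @ v)"
  by (simp add: dihedral_def presented_group_mult)

lemma dihedral_one: "\<one>\<^bsub>dihedral n\<^esub> = pres_class (dihedral_rels n) []"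
  by (simp add: dihedral_def presented_group_def)

lemma carrier_dihedral: "carrier (dihedral n) = range (pres_class (dihedral_rels n))"
  by (simp add: dihedral_def presented_group_def)

lemma class_in_dihedral: "pres_class (dihedral_rels n) u \<in> carrier (dihedral n)"
  by (simp add: carrier_dihedral)

lemma dih_r_closed: "dih_r n \<in> carrier (dihedral n)"
  and dih_s_closed: "dih_s n \<in> carrier (dihedral n)"
  by (simp_all add: dih_r_def dih_s_def pres_gen_def class_in_dihedral)

lemma class_dihedral_rels:
  "(l, r) \<in> dihedral_rels n \<Longrightarrow> pres_class (dihedral_rels n) l = pres_class (dihedral_rels n) r"
  using pres_eq.rel[of l r "dihedral_rels n" "[]" "[]"] by (simp add: pres_class_eq_iff)

lemma rotation_relation: "(replicate n (Rot, True), []) \<in> dihedral_rels n"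
  and reflection_relation: "([(Refl, True), (Refl, True)], []) \<in> dihedral_rels n"
  and commutation_relation:
    "([(Rot, True), (Refl, True)], [(Refl, True), (Rot, False)]) \<in> dihedral_rels n"
  by (simp_all add: dihedral_rels_def)

lemma class_inverse_letter:
  "pres_class (dihedral_rels n) [(g, False)]
     = inv\<^bsub>dihedral n\<^esub> pres_class (dihedral_rels n) [(g, True)]"
proof -
  interpret group "dihedral n" by (rule group_dihedral)
  have "pres_eq (dihedral_rels n) [(g, False), (g, True)] []"
    using pres_eq.cancel[of _ "[]" g False "[]"] by simp
  then show ?thesis
    by (intro inv_equality[symmetric])
      (simp_all add: dihedral_mult dihedral_one class_in_dihedral pres_class_eq_iff)
qed

lemma dih_r_power_eq_class:
  fixes m :: nat
  shows "dih_r n [^]\<^bsub>dihedral n\<^esub> m = pres_class (dihedral_rels n) (replicate m (Rot, True))"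
  by (induction m)
    (simp_all add: nat_pow_def dihedral_one dih_r_def pres_gen_def dihedral_mult
      replicate_append_same)

lemma dih_r_power_n: "dih_r n [^]\<^bsub>dihedral n\<^esub> n = \<one>\<^bsub>dihedral n\<^esub>"
  by (simp add: dih_r_power_eq_class dihedral_one class_dihedral_rels[OF rotation_relation])

lemma dih_s_square: "dih_s n \<otimes>\<^bsub>dihedral n\<^esub> dih_s n = \<one>\<^bsub>dihedral n\<^esub>"
  by (simp add: dih_s_def pres_gen_def dihedral_mult dihedral_one
      class_dihedral_rels[OF reflection_relation])

lemma dih_r_dih_s:
  "dih_r n \<otimes>\<^bsub>dihedral n\<^esub> dih_s n = dih_s n \<otimes>\<^bsub>dihedral n\<^esub> inv\<^bsub>dihedral n\<^esub> dih_r n"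
  using class_dihedral_rels[OF commutation_relation, of n]
  by (simp add: dih_s_def dih_r_def pres_gen_def dihedral_mult flip: class_inverse_letter)

lemmas dih_r_power_dih_s =
  group.rotation_reflection_commute[OF group_dihedral dih_r_closed dih_s_closed dih_r_dih_s]

fun normal_form :: "nat \<Rightarrow> bool \<times> int \<Rightarrow> dihedral_gen gword set" where
  "normal_form n (a, b) =
     (if a then dih_s n else \<one>\<^bsub>dihedral n\<^esub>) \<otimes>\<^bsub>dihedral n\<^esub> dih_r n [^]\<^bsub>dihedral n\<^esub> b"

text \<open>The action on pairs was chosen so that it becomes left multiplication in the group.\<close>

lemma letter_mult_normal_form:
  "pres_class (dihedral_rels n) [l] \<otimes>\<^bsub>dihedral n\<^esub> normal_form n x = normal_form n (act l x)"
proof -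
  interpret group "dihedral n" by (rule group_dihedral)
  note closed = dih_r_closed[of n] dih_s_closed[of n]
  let ?p = "\<lambda>c :: int. dih_r n [^]\<^bsub>dihedral n\<^esub> c"
  obtain g e a b where lx: "l = (g, e)" "x = (a, b)"
    by (cases l; cases x)
  show ?thesis
  proof (cases g)
    case Rot
    define c :: int where "c = (if e then 1 else - 1)"
    have "pres_class (dihedral_rels n) [l] = ?p c"
      using closed
      by (simp add: lx Rot c_def dih_r_def pres_gen_def class_inverse_letter int_pow_neg)
    moreover have "?p c \<otimes>\<^bsub>dihedral n\<^esub> (dih_s n \<otimes>\<^bsub>dihedral n\<^esub> ?p b) = dih_s n \<otimes>\<^bsub>dihedral n\<^esub> ?p (- c + b)"
    proof -
      have "?p c \<otimes>\<^bsub>dihedral n\<^esub> (dih_s n \<otimes>\<^bsub>dihedral n\<^esub> ?p b) = ?p c \<otimes>\<^bsub>dihedral n\<^esub> dih_s n \<otimes>\<^bsub>dihedral n\<^esub> ?p b"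
        using closed by (simp add: m_assoc)
      also have "\<dots> = dih_s n \<otimes>\<^bsub>dihedral n\<^esub> (?p (- c) \<otimes>\<^bsub>dihedral n\<^esub> ?p b)"
        using closed by (simp only: dih_r_power_dih_s m_assoc int_pow_closed)
      finally show ?thesis
        using closed by (simp only: int_pow_mult)
    qed
    moreover have "?p c \<otimes>\<^bsub>dihedral n\<^esub> dih_r n [^]\<^bsub>dihedral n\<^esub> b
        = ?p (c + b)"
      using closed by (simp add: int_pow_mult)
    ultimately show ?thesis
      using closed by (auto simp: lx Rot c_def add.commute)
  next
    case Refl
    have "inv\<^bsub>dihedral n\<^esub> dih_s n = dih_s n"
      using closed dih_s_square by (intro inv_equality) simp_all
    then have "pres_class (dihedral_rels n) [l] = dih_s n"
      by (cases e) (simp_all add: lx Refl dih_s_def pres_gen_def class_inverse_letter)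
    then show ?thesis
      using closed by (simp add: lx Refl dih_s_square flip: m_assoc)
  qed
qed

lemma class_eq_normal_form: "pres_class (dihedral_rels n) u = normal_form n (coords u)"
proof (induction u)
  case Nil
  interpret group "dihedral n" by (rule group_dihedral)
  show ?case by (simp add: coords_def dihedral_one[symmetric])
next
  case (Cons l u)
  show ?case
    using dihedral_mult[of n "[l]" u] letter_mult_normal_form[of n l "coords u"]
    by (simp add: Cons.IH coords_def)
qed

lemma reflection_square:
  "normal_form n (True, b) [^]\<^bsub>dihedral n\<^esub> (2 :: nat) = \<one>\<^bsub>dihedral n\<^esub>"
proof -
  interpret group "dihedral n" by (rule group_dihedral)
  note closed = dih_r_closed[of n] dih_s_closed[of n]
  let ?s = "dih_s n" and ?p = "\<lambda>c :: int. dih_r n [^]\<^bsub>dihedral n\<^esub> c"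
  have "?s \<otimes>\<^bsub>dihedral n\<^esub> ?p b \<otimes>\<^bsub>dihedral n\<^esub> (?s \<otimes>\<^bsub>dihedral n\<^esub> ?p b)
      = ?s \<otimes>\<^bsub>dihedral n\<^esub> (?p b \<otimes>\<^bsub>dihedral n\<^esub> ?s) \<otimes>\<^bsub>dihedral n\<^esub> ?p b"
    using closed by (simp add: m_assoc)
  also have "\<dots> = ?s \<otimes>\<^bsub>dihedral n\<^esub> ?s \<otimes>\<^bsub>dihedral n\<^esub> (?p (- b) \<otimes>\<^bsub>dihedral n\<^esub> ?p b)"
    using closed by (simp add: dih_r_power_dih_s m_assoc)
  also have "\<dots> = \<one>\<^bsub>dihedral n\<^esub>"
    using closed by (simp add: dih_s_square flip: int_pow_mult)
  finally show ?thesis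
    using closed by (simp add: numeral_2_eq_2)
qed

section \<open>The map to the cyclic group\<close>

fun cyclic_value :: "nat \<Rightarrow> int \<Rightarrow> bool \<times> int \<Rightarrow> int" where
  "cyclic_value n k (a, b) = (k * of_bool a + 2 * b) mod (2 * int n)"

lemma cyclic_value_cong: "coords_cong n x y \<Longrightarrow> cyclic_value n k x = cyclic_value n k y"
proof -
  assume cong: "coords_cong n x y"
  obtain a b a' b' where xy: "x = (a, b)" "y = (a', b')"
    by (cases x; cases y)
  have "2 * int n dvd 2 * (b - b')"
    using cong by (simp only: coords_cong_def xy fst_conv snd_conv mult_dvd_mono dvd_refl)
  then have "2 * int n dvd (k * of_bool a + 2 * b) - (k * of_bool a' + 2 * b')"
    using cong by (simp add: coords_cong_def xy right_diff_distrib)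
  then show ?thesis
    by (simp add: xy mod_eq_dvd_iff)
qed

text \<open>A word that represents the element is chosen; which one does not matter, by the next lemma.\<close>

definition dihedral_to_cyclic :: "nat \<Rightarrow> int \<Rightarrow> dihedral_gen gword set \<Rightarrow> int" where
  "dihedral_to_cyclic n k x = cyclic_value n k (coords (inv_into UNIV (pres_class (dihedral_rels n)) x))"

lemma dihedral_to_cyclic_class:
  "dihedral_to_cyclic n k (pres_class (dihedral_rels n) u) = cyclic_value n k (coords u)"
proof -
  let ?c = "pres_class (dihedral_rels n)"
  have "?c (inv_into UNIV ?c (?c u)) = ?c u"
    by (simp add: f_inv_into_f)
  then have "coords_cong n (coords (inv_into UNIV ?c (?c u))) (coords u)"
    unfolding coords_def pres_class_eq_iff by (rule act_word_pres_eq)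
  then show ?thesis
    unfolding dihedral_to_cyclic_def by (rule cyclic_value_cong)
qed

lemma dihedral_to_cyclic_normal_form:
  assumes "b \<ge> 0"
  shows "dihedral_to_cyclic n k (normal_form n (a, b)) = cyclic_value n k (a, b)"
proof -
  \<comment> \<open>the word \<open>s\<^sup>a r\<^sup>b\<close> itself, which for \<open>b \<ge> 0\<close> needs no inverse letters\<close>
  let ?u = "(if a then [(Refl, True)] else []) @ replicate (nat b) (Rot, True)"
  have coords: "coords ?u = (a, b)"
    using assms by (simp add: coords_def act_word_rotations del: foldr_replicate)
  show ?thesis
    using dihedral_to_cyclic_class[of n k ?u] by (simp add: class_eq_normal_form coords)
qed

text \<open>
  This is the divisibility of the orders, with \<open>d\<close> the order of the value in \<open>\<int>\<^bsub>2n\<^esub>\<close>. For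
  \<open>a = 1\<close> only the parity of the value matters: \<open>d (k + 2b)\<close> is even and its second factor is
  odd, so \<open>d\<close> is even.
\<close>

lemma normal_form_pow_eq_one:
  assumes "odd k" and dvd: "2 * int n dvd int d * (k * of_bool a + 2 * b)"
  shows "normal_form n (a, b) [^]\<^bsub>dihedral n\<^esub> d = \<one>\<^bsub>dihedral n\<^esub>"
proof -
  interpret group "dihedral n" by (rule group_dihedral)
  note closed = dih_r_closed[of n] dih_s_closed[of n]
  show ?thesis
  proof (cases a)
    case True
    have "even (int d * (k + 2 * b))"
      using dvd_mult_left[OF dvd] True by simp
    then have "even d"
      using \<open>odd k\<close> by simp
    then obtain m where d: "d = 2 * m" ..
    have "normal_form n (a, b) [^]\<^bsub>dihedral n\<^esub> d
        = (normal_form n (True, b) [^]\<^bsub>dihedral n\<^esub> (2 :: nat)) [^]\<^bsub>dihedral n\<^esub> m"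
      using closed by (simp add: d True nat_pow_pow)
    then show ?thesis
      by (simp only: reflection_square nat_pow_one)
  next
    case False
    have "int n dvd b * int d"
      using dvd False by (simp add: algebra_simps)
    then obtain c where c: "b * int d = int n * c" ..
    have "normal_form n (a, b) [^]\<^bsub>dihedral n\<^esub> d = dih_r n [^]\<^bsub>dihedral n\<^esub> (b * int d)"
      using closed False by (simp flip: int_pow_int add: int_pow_pow)
    also have "\<dots> = (dih_r n [^]\<^bsub>dihedral n\<^esub> n) [^]\<^bsub>dihedral n\<^esub> c"
      using closed by (simp add: c int_pow_pow flip: int_pow_int)
    finally show ?thesis
      by (simp add: dih_r_power_n)
  qed
qed

theorem theorem3p3:
  fixes n :: nat and k :: int
  assumes "n \<ge> 1" and "odd k"
  shows "\<exists>f. f \<in> carrier (dihedral n) \<rightarrow> carrier (integer_mod_group (2 * n)) \<and>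
      (\<forall>a\<in>{0, 1 :: int}. \<forall>b\<in>carrier (integer_mod_group n).
         f (dih_s n [^]\<^bsub>dihedral n\<^esub> a \<otimes>\<^bsub>dihedral n\<^esub> dih_r n [^]\<^bsub>dihedral n\<^esub> b)
           = (k * a + 2 * b) mod (2 * int n)) \<and>
      (\<forall>x\<in>carrier (dihedral n).
         group.ord (dihedral n) x dvd group.ord (integer_mod_group (2 * n)) (f x))"
proof (intro exI conjI ballI)
  interpret D: group "dihedral n" by (rule group_dihedral)
  interpret Z: group "integer_mod_group (2 * n)" by (rule group_integer_mod_group)
  let ?f = "dihedral_to_cyclic n k"
  have f_class: "?f (pres_class (dihedral_rels n) u) \<in> carrier (integer_mod_group (2 * n))" for u
    using \<open>n \<ge> 1\<close> by (cases "coords u") (simp add: dihedral_to_cyclic_class carrier_integer_mod_group)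
  then show "?f \<in> carrier (dihedral n) \<rightarrow> carrier (integer_mod_group (2 * n))"
    by (auto simp: carrier_dihedral)
  show "?f (dih_s n [^]\<^bsub>dihedral n\<^esub> a \<otimes>\<^bsub>dihedral n\<^esub> dih_r n [^]\<^bsub>dihedral n\<^esub> b)
      = (k * a + 2 * b) mod (2 * int n)"
    if a: "a \<in> {0, 1 :: int}" and b: "b \<in> carrier (integer_mod_group n)" for a b
  proof -
    have "b \<ge> 0"
      using b \<open>n \<ge> 1\<close> by (simp add: carrier_integer_mod_group)
    from dihedral_to_cyclic_normal_form[OF this, of n k "a = 1"] show ?thesis
      using a dih_s_closed[of n] by auto
  qed
  fix x assume x: "x \<in> carrier (dihedral n)"
  then obtain u a b where u: "x = pres_class (dihedral_rels n) u" and ab: "coords u = (a, b)"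
    by (metis carrier_dihedral imageE surj_pair)
  let ?d = "Z.ord (?f x)"
  have "?f x [^]\<^bsub>integer_mod_group (2 * n)\<^esub> ?d = 0"
    using Z.pow_ord_eq_1[of "?f x"] f_class by (simp add: u del: pow_integer_mod_group)
  then have "2 * int n dvd int ?d * (k * of_bool a + 2 * b)"
    by (simp add: u dihedral_to_cyclic_class ab mod_mult_right_eq mod_eq_0_iff_dvd)
  from normal_form_pow_eq_one[OF \<open>odd k\<close> this] have "x [^]\<^bsub>dihedral n\<^esub> ?d = \<one>\<^bsub>dihedral n\<^esub>"
    by (simp only: u class_eq_normal_form ab)
  then show "D.ord x dvd ?d"
    using x by (simp add: D.pow_eq_id)
qed

end
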